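(* Let $(X,p,E)$ be a lattice-normed Riesz space, let $B$ be a projection band in $X$ and let $P_B:X\to X$ be the corresponding band projection onto $B$. If a sequence $(x_n)$ in $X$ is statistically unbounded $p$-convergent to $x\in X$, then $(P_B(x_n))$ is statistically unbounded $p$-convergent to $P_B(x)$.
   Context: All Riesz spaces (vector lattices) are real and Archimedean; sequences are indexed by the positive integers $\mathbb{N}$; $E_+$ and $X_+$ denote positive cones. A lattice-normed Riesz space $(X,p,E)$ consists of Riesz spaces $X$ and $E$ and a map $p:X\to E_+$ with $p(x)=0\Leftrightarrow x=0$, $p(\lambda x)=|\lambda|p(x)$ for $\lambda\in\mathbb{R}$, $p(x+y)\le p(x)+p(y)$, which is monotone: $|x|\le|y|$ implies $p(x)\le p(y)$. The natural density of $K\subseteq\mathbb{N}$ is $\delta(K)=\lim_{n}\frac1n|\{k\le n:k\in K\}|$. A sequence $(q_n)$ in $E$ is statistically order decreasing to $0$, written $q_n\downarrow^{st}0$, if there is $K\subseteq\mathbb{N}$ with $\delta(K)=1$ such that $(q_k)_{k\in K}$ is decreasing and $\inf_{k\in K}q_k=0$. A sequence $(x_n)$ in $X$ is statistically unbounded $p$-convergent ($st$-$up$-convergent) to $x\in X$ if for every $u\in X_+$ there exist a sequence $q_n\downarrow^{st}0$ in $E$ and a set $K\subseteq\mathbb{N}$ with $\delta(K)=1$ such that $p(|x_k-x|\wedge u)\le q_k$ for all $k\in K$. *)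

theory Defs
  imports "HOL-Analysis.Analysis" "HOL-Library.Lattice_Algebras" "HOL-Library.Lub_Glb"
begin

text \<open>
  A Riesz space is a type of the following class. The superclass
  \<open>lattice_ab_group_add_abs\<close> says that \<open>\<bar>x\<bar> = sup x (- x)\<close>.
\<close>

class riesz_space = ordered_real_vector + lattice_ab_group_add_abs

class archimedean_riesz_space = riesz_space +
  assumes riesz_archimedean: "0 \<le> x \<Longrightarrow> (\<And>n::nat. real n *\<^sub>R x \<le> y) \<Longrightarrow> x = 0"

definition lattice_norm ::
  "('x::archimedean_riesz_space \<Rightarrow> 'e::archimedean_riesz_space) \<Rightarrow> bool" where
  "lattice_norm p \<longleftrightarrow>
     (\<forall>x. 0 \<le> p x) \<and>
     (\<forall>x. p x = 0 \<longleftrightarrow> x = 0) \<and>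
     (\<forall>c x. p (c *\<^sub>R x) = \<bar>c\<bar> *\<^sub>R p x) \<and>
     (\<forall>x y. p (x + y) \<le> p x + p y) \<and>
     (\<forall>x y. \<bar>x\<bar> \<le> \<bar>y\<bar> \<longrightarrow> p x \<le> p y)"

definition riesz_ideal :: "'x::riesz_space set \<Rightarrow> bool" where
  "riesz_ideal B \<longleftrightarrow> subspace B \<and> (\<forall>x y. y \<in> B \<longrightarrow> \<bar>x\<bar> \<le> \<bar>y\<bar> \<longrightarrow> x \<in> B)"

text \<open>
  An ideal is a band if it contains the supremum of each of its subsets whose supremum
  exists in the whole space.
\<close>

definition riesz_band :: "'x::riesz_space set \<Rightarrow> bool" where
  "riesz_band B \<longleftrightarrow> riesz_ideal B \<and> (\<forall>A s. A \<subseteq> B \<longrightarrow> isLub UNIV A s \<longrightarrow> s \<in> B)"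

definition disjoint_complement :: "'x::riesz_space set \<Rightarrow> 'x set" where
  "disjoint_complement B = {x. \<forall>y\<in>B. inf \<bar>x\<bar> \<bar>y\<bar> = 0}"

text \<open>
  The second conjunct is the direct sum decomposition of the space into \<open>B\<close> and its
  disjoint complement; the band projection picks the component in \<open>B\<close>.
\<close>

definition projection_band :: "'x::riesz_space set \<Rightarrow> bool" where
  "projection_band B \<longleftrightarrow>
     riesz_band B \<and> (\<forall>x. \<exists>!b. b \<in> B \<and> x - b \<in> disjoint_complement B)"

definition band_projection :: "'x::riesz_space set \<Rightarrow> 'x \<Rightarrow> 'x" where
  "band_projection B x = (THE b. b \<in> B \<and> x - b \<in> disjoint_complement B)"

text \<open>
  Sequences are indexed by the positive integers: they are functions on \<open>nat\<close> whose value
  at \<open>0\<close> is irrelevant, because all index sets below are subsets of \<open>{1..}\<close>.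
\<close>

definition has_natural_density :: "nat set \<Rightarrow> real \<Rightarrow> bool" where
  "has_natural_density K d \<longleftrightarrow>
     (\<lambda>n. real (card {k \<in> {1..n}. k \<in> K}) / real n) \<longlonglongrightarrow> d"

definition st_decreasing_to_0 :: "(nat \<Rightarrow> 'e::archimedean_riesz_space) \<Rightarrow> bool" where
  "st_decreasing_to_0 q \<longleftrightarrow>
     (\<exists>K \<subseteq> {1..}. has_natural_density K 1 \<and> antimono_on K q \<and> isGlb UNIV (q ` K) 0)"

definition st_up_convergent ::
  "('x::archimedean_riesz_space \<Rightarrow> 'e::archimedean_riesz_space) \<Rightarrow> (nat \<Rightarrow> 'x) \<Rightarrow> 'x \<Rightarrow> bool"
  where
  "st_up_convergent p x l \<longleftrightarrow>
     (\<forall>u\<ge>0. \<exists>q. st_decreasing_to_0 q \<and>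
        (\<exists>K \<subseteq> {1..}. has_natural_density K 1 \<and> (\<forall>k\<in>K. p (inf \<bar>x k - l\<bar> u) \<le> q k)))"

end

theory Submission
  imports Defs
begin

text \<open>
  A band projection does not enlarge differences: \<open>x - y\<close> splits into the disjoint parts
  \<open>P\<^sub>B x - P\<^sub>B y \<in> B\<close> and \<open>(x - P\<^sub>B x) - (y - P\<^sub>B y)\<close>, and each of two disjoint summands is
  dominated in absolute value by their sum. Hence the sequence \<open>q\<close> and the index set witnessing
  the convergence of \<open>x\<close> also witness that of the projected sequence, since \<open>p\<close> is monotone.
\<close>

text \<open>Distributing addition over \<open>inf\<close> turns the right-hand side into the infimum
  of \<open>a + a\<close>, \<open>a + c\<close>, \<open>b + a\<close> and \<open>b + c\<close>. The
  left-hand side is below \<open>b + c\<close> outright, and below the other three because each is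
  \<open>a\<close> plus a nonnegative term.\<close>

lemma inf_add_le:
  fixes a b c :: "'a::lattice_ab_group_add"
  assumes "0 \<le> a" "0 \<le> b" "0 \<le> c"
  shows "inf a (b + c) \<le> inf a b + inf a c"
proof -
  have "inf a (b + c) \<le> a + a" "inf a (b + c) \<le> a + c" "inf a (b + c) \<le> b + a"
    using assms by (auto intro: le_infI1 simp: add_increasing add_increasing2)
  then show ?thesis
    by (simp add: add_inf_distrib_left add_inf_distrib_right)
qed

text \<open>Writing \<open>b = (b + d) - d\<close> puts \<bar>b\<bar> below \<bar>b + d\<bar> +
  \<bar>d\<bar>. Meeting this bound with \<bar>b\<bar> and splitting by \<open>inf_add_le\<close>,
  the part from \<bar>d\<bar> vanishes by disjointness.\<close>

lemma abs_le_abs_add_if_disjoint: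
  fixes b d :: "'a::lattice_ab_group_add_abs"
  assumes "inf \<bar>b\<bar> \<bar>d\<bar> = 0"
  shows "\<bar>b\<bar> \<le> \<bar>b + d\<bar>"
proof -
  have "\<bar>b\<bar> \<le> \<bar>b + d\<bar> + \<bar>d\<bar>"
    using abs_triangle_ineq4[of "b + d" d] by simp
  then have "\<bar>b\<bar> = inf \<bar>b\<bar> (\<bar>b + d\<bar> + \<bar>d\<bar>)"
    by (simp add: inf_absorb1)
  also have "\<dots> \<le> inf \<bar>b\<bar> \<bar>b + d\<bar> + inf \<bar>b\<bar> \<bar>d\<bar>"
    by (rule inf_add_le) simp_all
  finally show ?thesis
    using assms by simp
qed

text \<open>Applied to the residues of two points under a band projection, whose difference must
  again be disjoint from the band.\<close>

lemma disjoint_complement_diff: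
  assumes "x \<in> disjoint_complement B" "y \<in> disjoint_complement B"
  shows "x - y \<in> disjoint_complement B"
  unfolding disjoint_complement_def
proof (intro CollectI ballI antisym)
  fix z assume "z \<in> B"
  have "inf \<bar>x - y\<bar> \<bar>z\<bar> \<le> inf \<bar>z\<bar> (\<bar>x\<bar> + \<bar>y\<bar>)"
    by (simp add: abs_triangle_ineq4 le_infI1)
  also have "\<dots> \<le> inf \<bar>z\<bar> \<bar>x\<bar> + inf \<bar>z\<bar> \<bar>y\<bar>"
    by (rule inf_add_le) simp_all
  also have "\<dots> = 0"
    using assms \<open>z \<in> B\<close> by (simp add: disjoint_complement_def inf_commute[of "\<bar>z\<bar>"])
  finally show "inf \<bar>x - y\<bar> \<bar>z\<bar> \<le> 0" .
qed simp

lemma band_projection: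
  assumes "projection_band B"
  shows "band_projection B x \<in> B" "x - band_projection B x \<in> disjoint_complement B"
proof -
  have "\<exists>!b. b \<in> B \<and> x - b \<in> disjoint_complement B"
    using assms by (simp add: projection_band_def)
  from theI'[OF this] show "band_projection B x \<in> B"
    and "x - band_projection B x \<in> disjoint_complement B"
    by (simp_all add: band_projection_def)
qed

lemma abs_band_projection_diff_le:
  assumes "projection_band B"
  shows "\<bar>band_projection B x - band_projection B y\<bar> \<le> \<bar>x - y\<bar>"
proof -
  let ?b = "band_projection B x - band_projection B y"
  let ?d = "(x - band_projection B x) - (y - band_projection B y)"
  have "subspace B"
    using assms by (simp add: projection_band_def riesz_band_def riesz_ideal_def)
  then have "?b \<in> B"
    by (intro subspace_diff band_projection[OF assms])
  moreover have "?d \<in> disjoint_complement B"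
    by (intro disjoint_complement_diff band_projection[OF assms])
  ultimately have "inf \<bar>?b\<bar> \<bar>?d\<bar> = 0"
    by (simp add: disjoint_complement_def inf_commute)
  then have "\<bar>?b\<bar> \<le> \<bar>?b + ?d\<bar>"
    by (rule abs_le_abs_add_if_disjoint)
  also have "?b + ?d = x - y"
    by simp
  finally show ?thesis .
qed

text \<open>Isolates what depends on \<open>p\<close>: the band projection enters only through the
  pointwise domination \<open>le\<close>.\<close>

lemma st_up_convergent_mono:
  assumes "lattice_norm p" "st_up_convergent p x l"
    and le: "\<And>k. \<bar>y k - m\<bar> \<le> \<bar>x k - l\<bar>"
  shows "st_up_convergent p y m"
  unfolding st_up_convergent_def
proof (intro allI impI)
  fix u :: 'a assume "0 \<le> u"
  then obtain q K where q: "st_decreasing_to_0 q"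
    and K: "K \<subseteq> {1..}" "has_natural_density K 1" "\<forall>k\<in>K. p (inf \<bar>x k - l\<bar> u) \<le> q k"
    using assms(2) unfolding st_up_convergent_def by blast
  have "p (inf \<bar>y k - m\<bar> u) \<le> p (inf \<bar>x k - l\<bar> u)" for k
  proof -
    \<comment> \<open>Monotonicity of \<open>p\<close> compares absolute values. Since 0 \<le> u,
      both infima are nonnegative and the outer bars drop.\<close>
    have "\<bar>inf \<bar>y k - m\<bar> u\<bar> \<le> \<bar>inf \<bar>x k - l\<bar> u\<bar>"
      using \<open>0 \<le> u\<close> inf_mono[OF le order_refl] by (simp add: abs_of_nonneg)
    then show ?thesis
      using assms(1) by (simp add: lattice_norm_def)
  qed
  with K(3) have "\<forall>k\<in>K. p (inf \<bar>y k - m\<bar> u) \<le> q k"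
    by (blast intro: order_trans)
  with q K(1,2) show "\<exists>q. st_decreasing_to_0 q \<and>
      (\<exists>K\<subseteq>{1..}. has_natural_density K 1 \<and> (\<forall>k\<in>K. p (inf \<bar>y k - m\<bar> u) \<le> q k))"
    by blast
qed

theorem proposition4p7:
  fixes p :: "'x::archimedean_riesz_space \<Rightarrow> 'e::archimedean_riesz_space"
    and B :: "'x set"
    and x :: "nat \<Rightarrow> 'x"
    and l :: 'x
  assumes "lattice_norm p"
    and "projection_band B"
    and "st_up_convergent p x l"
  shows "st_up_convergent p (\<lambda>n. band_projection B (x n)) (band_projection B l)"
  using assms(1,3) abs_band_projection_diff_le[OF assms(2)] by (rule st_up_convergent_mono)

end
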